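(* Consider the generalized Riemann problem for the 1D ten-moment equations with source, nonsonic case. Assume that the 2-shear wave associated with $u_1-\frac c{\sqrt3}$ moves to the left and the 5-shear wave associated with $u_1+\frac c{\sqrt3}$ moves to the right. Then, with the coefficients defined in the context, $$\left(\tfrac{\mathcal D u_2}{\mathcal D t}\right)_{\ast\ast}=\frac{d_{5,L}b_{5,R}-d_{5,R}b_{5,L}}{a_{5,L}b_{5,R}-a_{5,R}b_{5,L}},\qquad\left(\tfrac{\mathcal D p_{12}}{\mathcal D t}\right)_{\ast\ast}=\frac{d_{5,L}a_{5,R}-d_{5,R}a_{5,L}}{a_{5,R}b_{5,L}-a_{5,L}b_{5,R}}.$$ It follows that, for $K=L,R$, $$\left(\tfrac{\partial u_2}{\partial t}\right)_{\ast\ast K}=\left(\tfrac{\mathcal D u_2}{\mathcal D t}\right)_{\ast\ast}+\frac{u_{1,\ast}}{p_{11,\ast}}\left[\left(\tfrac{\mathcal D p_{12}}{\mathcal D t}\right)_{\ast\ast}-\frac{2p_{12,\ast\ast}}{3p_{11,\ast}}\left(\tfrac{\mathcal D p_{11}}{\mathcal D t}\right)_\ast\right],$$ $$\left(\tfrac{\partial p_{12}}{\partial t}\right)_{\ast\ast K}=\left(\tfrac{\mathcal D p_{12}}{\mathcal D t}\right)_{\ast\ast}+\rho_{\ast K}u_{1,\ast}\left(\tfrac{\mathcal D u_2}{\mathcal D t}\right)_{\ast\ast}.$$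
   Context: **System.** $\mathbf V=(\rho,u_1,u_2,p_{11},p_{12},p_{22})^\top$ with $\rho>0$, $p_{11}>0$, $p_{11}p_{22}-p_{12}^2>0$; $W(x)$ is a given $C^1$ potential; $c=\sqrt{3p_{11}/\rho}$; $\frac{\mathcal D}{\mathcal D t}=\partial_t+u_1\partial_x$. Smooth solutions satisfy: $\frac{\mathcal D\rho}{\mathcal D t}+\rho\partial_xu_1=0$; $\frac{\mathcal D u_1}{\mathcal D t}+\frac1\rho\partial_xp_{11}=-\frac12W_x$; $\frac{\mathcal D u_2}{\mathcal D t}+\frac1\rho\partial_xp_{12}=0$; $\frac{\mathcal D p_{11}}{\mathcal D t}+3p_{11}\partial_xu_1=0$; $\frac{\mathcal D p_{12}}{\mathcal D t}+2p_{12}\partial_xu_1+p_{11}\partial_xu_2=0$; $\frac{\mathcal D p_{22}}{\mathcal D t}+p_{22}\partial_xu_1+2p_{12}\partial_xu_2=0$. **Generalized Riemann problem.** The initial data are linear on each side of $x=0$. Near $(0,0)$, $0<t\ll1$, the solution is piecewise smooth; from left to right there are a 1-wave, a smooth 2-shear curve (speed $u_1-c/\sqrt3$), a contact curve (speed $u_1$), a smooth 5-shear curve (speed $u_1+c/\sqrt3$) and a 6-wave, and the four regions between consecutive waves are labelled $\ast L,\ast\ast L,\ast\ast R,\ast R$. In each of them $\mathbf V$ and its first derivatives have limits at $(0,0)$; a region subscript denotes that limit. The limiting states are $\mathbf V_{\ast L}=(\rho_{\ast L},u_{1,\ast},u_{2,\ast L},p_{11,\ast},p_{12,\ast L},p_{22,\ast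 L})$, $\mathbf V_{\ast\ast L}=(\rho_{\ast L},u_{1,\ast},u_{2,\ast\ast},p_{11,\ast},p_{12,\ast\ast},p_{22,\ast\ast L})$, $\mathbf V_{\ast\ast R}=(\rho_{\ast R},u_{1,\ast},u_{2,\ast\ast},p_{11,\ast},p_{12,\ast\ast},p_{22,\ast\ast R})$, $\mathbf V_{\ast R}=(\rho_{\ast R},u_{1,\ast},u_{2,\ast R},p_{11,\ast},p_{12,\ast R},p_{22,\ast R})$; $c_{\ast K}=\sqrt{3p_{11,\ast}/\rho_{\ast K}}$. Along the 2-shear curve $\rho,u_1,p_{11},u_2+\frac{p_{12}}{\sqrt{\rho p_{11}}},\det(\mathbf p)=p_{11}p_{22}-p_{12}^2$ are continuous; along the 5-shear curve $\rho,u_1,p_{11},u_2-\frac{p_{12}}{\sqrt{\rho p_{11}}},\det(\mathbf p)$ are continuous; along the contact $u_1,u_2,p_{11},p_{12}$ are continuous. The limits $(\frac{\mathcal D u_1}{\mathcal D t})_\ast,(\frac{\mathcal D p_{11}}{\mathcal D t})_\ast$ are common to the four regions, and $(\frac{\mathcal D u_2}{\mathcal D t})_{\ast\ast},(\frac{\mathcal D p_{12}}{\mathcal D t})_{\ast\ast}$ are common to $\ast\ast L$ and $\ast\ast R$. Nonsonic: the $t$-axis lies between the 1-wave and the 6-wave. **Notation.** $\lambda_2=u_{1,\ast}-\frac{c_{\ast L}}{\sqrt3}$, $\lambda_5=u_{1,\ast}+\frac{c_{\ast R}}{\sqrt3}$, $\frac{\mathcal D_i}{\mathcal D t}=\partial_t+\lambda_i\partial_x$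 ($i=2,5$). **Coefficients.** $a_{5,L}=a_{5,R}=2$, $b_{5,L}=\frac2{\sqrt{\rho_{\ast L}p_{11,\ast}}}$, $b_{5,R}=-\frac2{\sqrt{\rho_{\ast R}p_{11,\ast}}}$, $$d_{5,L}=\tfrac{p_{12,\ast\ast}-p_{12,\ast L}}{2\rho_{\ast L}\sqrt{\rho_{\ast L}p_{11,\ast}}}\left(\tfrac{\mathcal D_2\rho}{\mathcal D t}\right)_{\ast L}+\left(\tfrac{\mathcal D_2u_2}{\mathcal D t}\right)_{\ast L}+\tfrac{p_{12,\ast\ast}-p_{12,\ast L}}{2p_{11,\ast}\sqrt{\rho_{\ast L}p_{11,\ast}}}\left(\tfrac{\mathcal D_2p_{11}}{\mathcal D t}\right)_{\ast L}+\tfrac1{\sqrt{\rho_{\ast L}p_{11,\ast}}}\left(\tfrac{\mathcal D_2p_{12}}{\mathcal D t}\right)_{\ast L}-\tfrac{2p_{12,\ast\ast}(\lambda_2-u_{1,\ast})}{3p_{11,\ast}^2}\left(\tfrac{\mathcal D p_{11}}{\mathcal D t}\right)_\ast,$$ $$d_{5,R}=\tfrac{p_{12,\ast R}-p_{12,\ast\ast}}{2\rho_{\ast R}\sqrt{\rho_{\ast R}p_{11,\ast}}}\left(\tfrac{\mathcal D_5\rho}{\mathcal D t}\right)_{\ast R}+\left(\tfrac{\mathcal D_5u_2}{\mathcal D t}\right)_{\ast R}+\tfrac{p_{12,\ast R}-p_{12,\ast\ast}}{2p_{11,\ast}\sqrt{\rho_{\ast R}p_{11,\ast}}}\left(\tfrac{\mathcal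 D_5p_{11}}{\mathcal D t}\right)_{\ast R}-\tfrac1{\sqrt{\rho_{\ast R}p_{11,\ast}}}\left(\tfrac{\mathcal D_5p_{12}}{\mathcal D t}\right)_{\ast R}-\tfrac{2p_{12,\ast\ast}(\lambda_5-u_{1,\ast})}{3p_{11,\ast}^2}\left(\tfrac{\mathcal D p_{11}}{\mathcal D t}\right)_\ast.$$ *)

theory Defs
  imports "HOL-Analysis.Analysis"
begin

record state =
  rho :: real
  u1 :: real
  u2 :: real
  p11 :: real
  p12 :: real
  p22 :: real

definition detp :: "state \<Rightarrow> real" where
  "detp s = p11 s * p22 s - (p12 s)\<^sup>2"

definition admissible :: "state \<Rightarrow> bool" where
  "admissible s \<longleftrightarrow> rho s > 0 \<and> p11 s > 0 \<and> detp s > 0"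

definition c_speed :: "state \<Rightarrow> real" where
  "c_speed s = sqrt (3 * p11 s / rho s)"

definition components :: "(state \<Rightarrow> real) set" where
  "components = {rho, u1, u2, p11, p12, p22}"

subsection \<open>Functions of \<open>(x, t)\<close> and the ten-moment equations\<close>

definition dx :: "(real \<times> real \<Rightarrow> real) \<Rightarrow> real \<times> real \<Rightarrow> real" where
  "dx f = (\<lambda>(x, t). deriv (\<lambda>y. f (y, t)) x)"

definition dt :: "(real \<times> real \<Rightarrow> real) \<Rightarrow> real \<times> real \<Rightarrow> real" where
  "dt f = (\<lambda>(x, t). deriv (\<lambda>s. f (x, s)) t)"

definition material :: "(real \<times> real \<Rightarrow> state) \<Rightarrow> (state \<Rightarrow> real) \<Rightarrow> real \<times> real \<Rightarrow> real" where
  "material V q z = dt (q \<circ> V) z + u1 (V z) * dx (q \<circ> V) z"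

definition C1_on :: "(real \<times> real \<Rightarrow> real) \<Rightarrow> (real \<times> real) set \<Rightarrow> bool" where
  "C1_on f S \<longleftrightarrow> (\<forall>z\<in>S. f differentiable (at z)) \<and> continuous_on S (dx f) \<and> continuous_on S (dt f)"

definition ten_moment_eqs ::
  "(real \<Rightarrow> real) \<Rightarrow> (real \<times> real \<Rightarrow> state) \<Rightarrow> real \<times> real \<Rightarrow> bool" where
  "ten_moment_eqs W V z \<longleftrightarrow>
     material V rho z + rho (V z) * dx (u1 \<circ> V) z = 0 \<and>
     material V u1 z + 1 / rho (V z) * dx (p11 \<circ> V) z = - (1/2) * deriv W (fst z) \<and>
     material V u2 z + 1 / rho (V z) * dx (p12 \<circ> V) z = 0 \<and>
     material V p11 z + 3 * p11 (V z) * dx (u1 \<circ> V) z = 0 \<and>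
     material V p12 z + 2 * p12 (V z) * dx (u1 \<circ> V) z + p11 (V z) * dx (u2 \<circ> V) z = 0 \<and>
     material V p22 z + p22 (V z) * dx (u1 \<circ> V) z + 2 * p12 (V z) * dx (u2 \<circ> V) z = 0"

definition smooth_solution_on ::
  "(real \<Rightarrow> real) \<Rightarrow> (real \<times> real \<Rightarrow> state) \<Rightarrow> (real \<times> real) set \<Rightarrow> bool" where
  "smooth_solution_on W V S \<longleftrightarrow>
     (\<forall>q\<in>components. C1_on (q \<circ> V) S) \<and>
     (\<forall>z\<in>S. admissible (V z) \<and> ten_moment_eqs W V z)"

subsection \<open>The wave pattern\<close>

text \<open>The solution is considered for \<open>- width < x < width\<close>, \<open>0 \<le> t < horizon\<close>. Every wave is given
  by curves \<open>x = \<xi>(t)\<close>. The 1-wave and the 6-wave fill the sets between their left and right edges;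
  the edges coincide exactly when the wave is a shock.\<close>

record grp =
  potential :: "real \<Rightarrow> real"
  sol :: "real \<times> real \<Rightarrow> state"
  width :: real
  horizon :: real
  wave1_left :: "real \<Rightarrow> real"
  wave1_right :: "real \<Rightarrow> real"
  shear2 :: "real \<Rightarrow> real"
  contact :: "real \<Rightarrow> real"
  shear5 :: "real \<Rightarrow> real"
  wave6_left :: "real \<Rightarrow> real"
  wave6_right :: "real \<Rightarrow> real"

definition time_dom :: "grp \<Rightarrow> real set" where
  "time_dom G = {0<..<horizon G}"

definition strip :: "grp \<Rightarrow> (real \<Rightarrow> real) \<Rightarrow> (real \<Rightarrow> real) \<Rightarrow> (real \<times> real) set" where
  "strip G a b = {(x, t). t \<in> time_dom G \<and> a t < x \<and> x < b t}"

text \<open>The four regions \<open>*L\<close>, \<open>**L\<close>, \<open>**R\<close>, \<open>*R\<close>.\<close>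

datatype region = SL | SSL | SSR | SR

fun zone :: "grp \<Rightarrow> region \<Rightarrow> (real \<times> real) set" where
  "zone G SL = strip G (wave1_right G) (shear2 G)"
| "zone G SSL = strip G (shear2 G) (contact G)"
| "zone G SSR = strip G (contact G) (shear5 G)"
| "zone G SR = strip G (shear5 G) (wave6_left G)"

definition left_zone :: "grp \<Rightarrow> (real \<times> real) set" where
  "left_zone G = strip G (\<lambda>_. - width G) (wave1_left G)"

definition right_zone :: "grp \<Rightarrow> (real \<times> real) set" where
  "right_zone G = strip G (wave6_right G) (\<lambda>_. width G)"

text \<open>\<open>at\<close> is the punctured neighbourhood filter, so the next two definitions only involve the traces
  from the two sides of the curve and not the values of \<open>sol G\<close> on it.\<close>

definition continuous_across :: "grp \<Rightarrow> (state \<Rightarrow> real) \<Rightarrow> (real \<Rightarrow> real) \<Rightarrow> bool" where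
  "continuous_across G q \<xi> \<longleftrightarrow>
     (\<forall>t\<in>time_dom G. \<exists>l. ((\<lambda>x. q (sol G (x, t))) \<longlongrightarrow> l) (at (\<xi> t)))"

definition moves_with :: "grp \<Rightarrow> (real \<Rightarrow> real) \<Rightarrow> (state \<Rightarrow> real) \<Rightarrow> bool" where
  "moves_with G \<xi> \<mu> \<longleftrightarrow> \<xi> C1_differentiable_on time_dom G \<and>
     (\<forall>t\<in>time_dom G. \<exists>s. ((\<lambda>x. \<mu> (sol G (x, t))) \<longlongrightarrow> s) (at (\<xi> t)) \<and> (\<xi> has_real_derivative s) (at t))"

definition side_limit :: "grp \<Rightarrow> real \<Rightarrow> real filter \<Rightarrow> state \<Rightarrow> bool" where
  "side_limit G t F s \<longleftrightarrow> (\<forall>q\<in>components. ((\<lambda>x. q (sol G (x, t))) \<longlongrightarrow> q s) F)"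

text \<open>Conserved quantities (mass, momentum, and twice the energy tensor
  \<open>E = (\<rho> u \<otimes> u + p) / 2\<close>) with their fluxes in the \<open>x\<close> direction.\<close>

definition conservation_laws :: "((state \<Rightarrow> real) \<times> (state \<Rightarrow> real)) set" where
  "conservation_laws =
    {(rho, \<lambda>s. rho s * u1 s),
     (\<lambda>s. rho s * u1 s, \<lambda>s. rho s * (u1 s)\<^sup>2 + p11 s),
     (\<lambda>s. rho s * u2 s, \<lambda>s. rho s * u1 s * u2 s + p12 s),
     (\<lambda>s. rho s * (u1 s)\<^sup>2 + p11 s, \<lambda>s. rho s * (u1 s)^3 + 3 * p11 s * u1 s),
     (\<lambda>s. rho s * u1 s * u2 s + p12 s,
      \<lambda>s. rho s * (u1 s)\<^sup>2 * u2 s + 2 * p12 s * u1 s + p11 s * u2 s),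
     (\<lambda>s. rho s * (u2 s)\<^sup>2 + p22 s,
      \<lambda>s. rho s * u1 s * (u2 s)\<^sup>2 + p22 s * u1 s + 2 * p12 s * u2 s)}"

text \<open>Rankine--Hugoniot and Lax conditions for the characteristic speed \<open>\<mu>\<close>. The Lax inequalities
  are not strict, so that the degenerate wave without a jump (a weak discontinuity along a
  characteristic) is included.\<close>

definition shock :: "grp \<Rightarrow> (state \<Rightarrow> real) \<Rightarrow> (real \<Rightarrow> real) \<Rightarrow> (real \<Rightarrow> real) \<Rightarrow> bool" where
  "shock G \<mu> a b \<longleftrightarrow> a C1_differentiable_on time_dom G \<and>
     (\<forall>t\<in>time_dom G. a t = b t \<and>
        (\<exists>sl sr. side_limit G t (at_left (a t)) sl \<and> side_limit G t (at_right (a t)) sr \<and>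
           admissible sl \<and> admissible sr \<and>
           (\<forall>(w, f)\<in>conservation_laws. deriv a t * (w sr - w sl) = f sr - f sl) \<and>
           \<mu> sr \<le> deriv a t \<and> deriv a t \<le> \<mu> sl))"

definition rarefaction :: "grp \<Rightarrow> (state \<Rightarrow> real) \<Rightarrow> (real \<Rightarrow> real) \<Rightarrow> (real \<Rightarrow> real) \<Rightarrow> bool" where
  "rarefaction G \<mu> a b \<longleftrightarrow>
     (\<forall>t\<in>time_dom G. a t < b t) \<and>
     moves_with G a \<mu> \<and> moves_with G b \<mu> \<and>
     smooth_solution_on (potential G) (sol G) (strip G a b) \<and>
     (\<forall>q\<in>components. continuous_across G q a \<and> continuous_across G q b)"

definition nonlinear_wave :: "grp \<Rightarrow> (state \<Rightarrow> real) \<Rightarrow> (real \<Rightarrow> real) \<Rightarrow> (real \<Rightarrow> real) \<Rightarrow> bool" where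
  "nonlinear_wave G \<mu> a b \<longleftrightarrow> shock G \<mu> a b \<or> rarefaction G \<mu> a b"

definition wave_pattern :: "grp \<Rightarrow> bool" where
  "wave_pattern G \<longleftrightarrow>
     (\<forall>\<xi>\<in>{wave1_left G, wave1_right G, shear2 G, contact G, shear5 G, wave6_left G, wave6_right G}.
        (\<xi> \<longlongrightarrow> 0) (at_right 0)) \<and>
     (\<forall>t\<in>time_dom G.
        - width G < wave1_left G t \<and> wave1_left G t \<le> wave1_right G t \<and>
        wave1_right G t < shear2 G t \<and> shear2 G t < contact G t \<and> contact G t < shear5 G t \<and>
        shear5 G t < wave6_left G t \<and> wave6_left G t \<le> wave6_right G t \<and>
        wave6_right G t < width G) \<and>
     nonlinear_wave G (\<lambda>s. u1 s - c_speed s) (wave1_left G) (wave1_right G) \<and>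
     moves_with G (shear2 G) (\<lambda>s. u1 s - c_speed s / sqrt 3) \<and>
     moves_with G (contact G) u1 \<and>
     moves_with G (shear5 G) (\<lambda>s. u1 s + c_speed s / sqrt 3) \<and>
     nonlinear_wave G (\<lambda>s. u1 s + c_speed s) (wave6_left G) (wave6_right G) \<and>
     (\<forall>q\<in>{rho, u1, p11, (\<lambda>s. u2 s + p12 s / sqrt (rho s * p11 s)), detp}.
        continuous_across G q (shear2 G)) \<and>
     (\<forall>q\<in>{u1, u2, p11, p12}. continuous_across G q (contact G)) \<and>
     (\<forall>q\<in>{rho, u1, p11, (\<lambda>s. u2 s - p12 s / sqrt (rho s * p11 s)), detp}.
        continuous_across G q (shear5 G))"

subsection \<open>Initial data\<close>

definition linear_data_on :: "grp \<Rightarrow> real set \<Rightarrow> bool" where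
  "linear_data_on G I \<longleftrightarrow>
     (\<forall>q\<in>components. \<exists>a b. \<forall>x\<in>I. q (sol G (x, 0)) = a + b * x) \<and>
     (\<forall>x\<in>I. admissible (sol G (x, 0)))"

text \<open>The last two clauses say that the solution attains the data at \<open>t = 0\<close> away from \<open>x = 0\<close>.\<close>

definition initial_condition :: "grp \<Rightarrow> bool" where
  "initial_condition G \<longleftrightarrow>
     linear_data_on G {- width G<..<0} \<and> linear_data_on G {0<..<width G} \<and>
     (\<forall>q\<in>components.
        continuous_on (left_zone G \<union> {- width G<..<0} \<times> {0}) (q \<circ> sol G) \<and>
        continuous_on (right_zone G \<union> {0<..<width G} \<times> {0}) (q \<circ> sol G))"

subsection \<open>Limits at the origin\<close>

definition has_lim :: "grp \<Rightarrow> region \<Rightarrow> (real \<times> real \<Rightarrow> real) \<Rightarrow> bool" where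
  "has_lim G K f \<longleftrightarrow> (\<exists>l. (f \<longlongrightarrow> l) (at (0, 0) within zone G K))"

definition origin_lim :: "grp \<Rightarrow> region \<Rightarrow> (real \<times> real \<Rightarrow> real) \<Rightarrow> real" where
  "origin_lim G K f = Lim (at (0, 0) within zone G K) f"

definition limits_exist :: "grp \<Rightarrow> bool" where
  "limits_exist G \<longleftrightarrow>
     (\<forall>K. \<forall>q\<in>components. has_lim G K (q \<circ> sol G) \<and>
        has_lim G K (dx (q \<circ> sol G)) \<and> has_lim G K (dt (q \<circ> sol G)))"

definition lim_state :: "grp \<Rightarrow> region \<Rightarrow> state" where
  "lim_state G K =
     \<lparr>rho = origin_lim G K (rho \<circ> sol G), u1 = origin_lim G K (u1 \<circ> sol G),
      u2 = origin_lim G K (u2 \<circ> sol G), p11 = origin_lim G K (p11 \<circ> sol G),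
      p12 = origin_lim G K (p12 \<circ> sol G), p22 = origin_lim G K (p22 \<circ> sol G)\<rparr>"

definition lim_material :: "grp \<Rightarrow> region \<Rightarrow> (state \<Rightarrow> real) \<Rightarrow> real" where
  "lim_material G K q = origin_lim G K (material (sol G) q)"

text \<open>Limits that several regions share: below, the names with a suffix \<open>_s\<close> (one star) or
  \<open>_ss\<close> (two stars) are read off in one of these regions.\<close>

definition common_limits :: "grp \<Rightarrow> bool" where
  "common_limits G \<longleftrightarrow>
     (\<forall>K. admissible (lim_state G K) \<and>
        u1 (lim_state G K) = u1 (lim_state G SL) \<and> p11 (lim_state G K) = p11 (lim_state G SL) \<and>
        lim_material G K u1 = lim_material G SL u1 \<and>
        lim_material G K p11 = lim_material G SL p11) \<and>
     rho (lim_state G SSL) = rho (lim_state G SL) \<and>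
     rho (lim_state G SSR) = rho (lim_state G SR) \<and>
     u2 (lim_state G SSL) = u2 (lim_state G SSR) \<and>
     p12 (lim_state G SSL) = p12 (lim_state G SSR) \<and>
     lim_material G SSL u2 = lim_material G SSR u2 \<and>
     lim_material G SSL p12 = lim_material G SSR p12"

definition grp_solution :: "grp \<Rightarrow> bool" where
  "grp_solution G \<longleftrightarrow>
     width G > 0 \<and> horizon G > 0 \<and>
     potential G C1_differentiable_on UNIV \<and>
     wave_pattern G \<and>
     (\<forall>S\<in>{left_zone G, right_zone G} \<union> range (zone G).
        smooth_solution_on (potential G) (sol G) S) \<and>
     initial_condition G \<and> limits_exist G \<and> common_limits G"

definition nonsonic :: "grp \<Rightarrow> bool" where
  "nonsonic G \<longleftrightarrow> (\<forall>t\<in>time_dom G. wave1_right G t < 0 \<and> 0 < wave6_left G t)"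

subsection \<open>Limiting values and coefficients\<close>

definition rho_sL :: "grp \<Rightarrow> real" where "rho_sL G = rho (lim_state G SL)"
definition rho_sR :: "grp \<Rightarrow> real" where "rho_sR G = rho (lim_state G SR)"
definition u1_s :: "grp \<Rightarrow> real" where "u1_s G = u1 (lim_state G SL)"
definition p11_s :: "grp \<Rightarrow> real" where "p11_s G = p11 (lim_state G SL)"
definition p12_sL :: "grp \<Rightarrow> real" where "p12_sL G = p12 (lim_state G SL)"
definition p12_ss :: "grp \<Rightarrow> real" where "p12_ss G = p12 (lim_state G SSL)"
definition p12_sR :: "grp \<Rightarrow> real" where "p12_sR G = p12 (lim_state G SR)"

definition Dp11_s :: "grp \<Rightarrow> real" where "Dp11_s G = lim_material G SL p11"
definition Du2_ss :: "grp \<Rightarrow> real" where "Du2_ss G = lim_material G SSL u2"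
definition Dp12_ss :: "grp \<Rightarrow> real" where "Dp12_ss G = lim_material G SSL p12"

definition lambda2 :: "grp \<Rightarrow> real" where
  "lambda2 G = u1_s G - c_speed (lim_state G SL) / sqrt 3"

definition lambda5 :: "grp \<Rightarrow> real" where
  "lambda5 G = u1_s G + c_speed (lim_state G SR) / sqrt 3"

text \<open>Limit of the derivative \<open>\<partial>\<^sub>t + \<lambda>\<^sub>i \<partial>\<^sub>x\<close> with the constant speeds \<open>lambda2\<close>, \<open>lambda5\<close>.\<close>

definition D2_sL :: "grp \<Rightarrow> (state \<Rightarrow> real) \<Rightarrow> real" where
  "D2_sL G q = origin_lim G SL (\<lambda>z. dt (q \<circ> sol G) z + lambda2 G * dx (q \<circ> sol G) z)"

definition D5_sR :: "grp \<Rightarrow> (state \<Rightarrow> real) \<Rightarrow> real" where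
  "D5_sR G q = origin_lim G SR (\<lambda>z. dt (q \<circ> sol G) z + lambda5 G * dx (q \<circ> sol G) z)"

definition a5L :: "grp \<Rightarrow> real" where "a5L G = 2"
definition a5R :: "grp \<Rightarrow> real" where "a5R G = 2"
definition b5L :: "grp \<Rightarrow> real" where "b5L G = 2 / sqrt (rho_sL G * p11_s G)"
definition b5R :: "grp \<Rightarrow> real" where "b5R G = - (2 / sqrt (rho_sR G * p11_s G))"

definition d5L :: "grp \<Rightarrow> real" where
  "d5L G =
     (p12_ss G - p12_sL G) / (2 * rho_sL G * sqrt (rho_sL G * p11_s G)) * D2_sL G rho
     + D2_sL G u2
     + (p12_ss G - p12_sL G) / (2 * p11_s G * sqrt (rho_sL G * p11_s G)) * D2_sL G p11
     + 1 / sqrt (rho_sL G * p11_s G) * D2_sL G p12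
     - 2 * p12_ss G * (lambda2 G - u1_s G) / (3 * (p11_s G)\<^sup>2) * Dp11_s G"

definition d5R :: "grp \<Rightarrow> real" where
  "d5R G =
     (p12_sR G - p12_ss G) / (2 * rho_sR G * sqrt (rho_sR G * p11_s G)) * D5_sR G rho
     + D5_sR G u2
     + (p12_sR G - p12_ss G) / (2 * p11_s G * sqrt (rho_sR G * p11_s G)) * D5_sR G p11
     - 1 / sqrt (rho_sR G * p11_s G) * D5_sR G p12
     - 2 * p12_ss G * (lambda5 G - u1_s G) / (3 * (p11_s G)\<^sup>2) * Dp11_s G"

end

theory Submission
  imports Defs
begin

text \<open>The material derivatives \<open>X = D u\<^sub>2/Dt\<close> and \<open>Y = D p\<^sub>1\<^sub>2/Dt\<close> at the origin between the
  two shear curves are determined by two linear equations, one contributed by each shear curve.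

  Such an equation arises as follows. The quantity \<open>f = u\<^sub>2 + \<sigma> p\<^sub>1\<^sub>2 / \<surd>(\<rho> p\<^sub>1\<^sub>1)\<close>, with
  \<open>\<sigma> = 1\<close> for the 2-shear and \<open>\<sigma> = -1\<close> for the 5-shear curve, has no jump across the curve,
  and neither have \<open>\<rho>\<close> and \<open>p\<^sub>1\<^sub>1\<close>. A function without a jump has the same derivative along the
  curve from both sides; at the origin this derivative is \<open>\<partial>\<^sub>t + v \<partial>\<^sub>x\<close>, where
  \<open>v = u\<^sub>1 - \<sigma> c/\<surd>3\<close> is the initial speed of the curve
  (lemma \<open>one_sided_derivatives_agree\<close>). On the outer side the derivatives of \<open>u\<^sub>2\<close> and
  \<open>p\<^sub>1\<^sub>2\<close> are kept as part of the right-hand side \<open>d\<close>; those of the factor \<open>1 / \<surd>(\<rho> p\<^sub>1\<^sub>1)\<close> agree on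
  both sides and enter \<open>d\<close> multiplied by the jump of \<open>p\<^sub>1\<^sub>2\<close>. On the inner side the limits of the
  evolution equations express the \<open>x\<close>-derivatives of \<open>p\<^sub>1\<^sub>2\<close> and \<open>u\<^sub>2\<close> through \<open>X\<close>, \<open>Y\<close> and the
  material derivative of \<open>p\<^sub>1\<^sub>1\<close>. Since \<open>v - u\<^sub>1 = -\<sigma> \<surd>(p\<^sub>1\<^sub>1/\<rho>)\<close>, the contribution of
  \<open>\<partial>\<^sub>x p\<^sub>1\<^sub>2\<close> is exactly another \<open>X\<close>, that of \<open>\<partial>\<^sub>x u\<^sub>2\<close> another \<open>\<sigma> Y/\<surd>(\<rho> p\<^sub>1\<^sub>1)\<close> together with
  the \<open>p\<^sub>1\<^sub>1\<close>-term of \<open>d\<close>; this explains the factors 2 in the coefficients \<open>a\<close> and \<open>b\<close>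
  (lemma \<open>shear_relation\<close>). The two equations have coefficients \<open>b\<close> of opposite signs, so
  Cramer's rule applies. The time derivatives follow by removing the convective part
  \<open>u\<^sub>1 \<partial>\<^sub>x\<close> from the material derivatives.

  The analytic difficulty is that the solution is differentiable only in the open regions, so that
  its trace on a curve need not be differentiable at any given time. Only difference quotients of
  the trace are used; they are estimated by the mean value theorem on slightly shifted copies of
  the curve, which lie in the open region.\<close>

section \<open>Partial derivatives\<close>

lemma has_derivative_imp_partials:
  assumes "(f has_derivative (\<lambda>w. fst w * a + snd w * b)) (at z)"
  shows "dx f z = a" and "dt f z = b"
proof -
  obtain x t where z: "z = (x, t)" by (cases z)
  have "((\<lambda>y. (y, t)) has_derivative (\<lambda>h. (h, 0))) (at x)"
    by (auto intro!: derivative_eq_intros)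
  from has_derivative_compose[OF this] assms
  have "((\<lambda>y. f (y, t)) has_derivative (\<lambda>h. h * a)) (at x)"
    unfolding z by fastforce
  then have "((\<lambda>y. f (y, t)) has_real_derivative a) (at x)"
    unfolding has_field_derivative_def by (simp add: mult_commute_abs)
  then show "dx f z = a"
    unfolding dx_def z by (simp add: DERIV_imp_deriv)
  have "((\<lambda>s. (x, s)) has_derivative (\<lambda>h. (0, h))) (at t)"
    by (auto intro!: derivative_eq_intros)
  from has_derivative_compose[OF this] assms
  have "((\<lambda>s. f (x, s)) has_derivative (\<lambda>h. h * b)) (at t)"
    unfolding z by fastforce
  then have "((\<lambda>s. f (x, s)) has_real_derivative b) (at t)"
    unfolding has_field_derivative_def by (simp add: mult_commute_abs)
  then show "dt f z = b"
    unfolding dt_def z by (simp add: DERIV_imp_deriv)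
qed

lemma differentiable_imp_has_derivative_partials:
  fixes f :: "real \<times> real \<Rightarrow> real"
  assumes "f differentiable (at z)"
  shows "(f has_derivative (\<lambda>w. fst w * dx f z + snd w * dt f z)) (at z)"
proof -
  obtain D where D: "(f has_derivative D) (at z)"
    using assms unfolding differentiable_def by blast
  interpret linear D by (rule has_derivative_linear[OF D])
  have "D w = fst w * D (1, 0) + snd w * D (0, 1)" for w
  proof -
    have "w = fst w *\<^sub>R (1, 0) + snd w *\<^sub>R (0, 1)" by (cases w) simp
    then have "D w = D (fst w *\<^sub>R (1, 0) + snd w *\<^sub>R (0, 1))" by simp
    also have "\<dots> = fst w * D (1, 0) + snd w * D (0, 1)" unfolding add scale by simp
    finally show ?thesis .
  qed
  then have "D = (\<lambda>w. fst w * D (1, 0) + snd w * D (0, 1))" by blast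
  with D have D': "(f has_derivative (\<lambda>w. fst w * D (1, 0) + snd w * D (0, 1))) (at z)" by simp
  show ?thesis using D' has_derivative_imp_partials[OF D'] by simp
qed

section \<open>One-sided derivatives along a curve\<close>

text \<open>\<open>S\<close> lies immediately next to the graph of \<open>\<xi>\<close>, on the right for \<open>\<sigma> = 1\<close> and on the left for
  \<open>\<sigma> = -1\<close>. The shift \<open>\<delta>\<close> has to be uniform over compact time intervals, because the mean value
  theorem is applied along a whole shifted arc.\<close>

definition borders :: "real \<Rightarrow> (real \<Rightarrow> real) \<Rightarrow> real \<Rightarrow> (real \<times> real) set \<Rightarrow> bool" where
  "borders T \<xi> \<sigma> S \<longleftrightarrow> \<bar>\<sigma>\<bar> = 1 \<and>
     (\<forall>s t. 0 < s \<longrightarrow> s \<le> t \<longrightarrow> t < T \<longrightarrow>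
        (\<forall>\<^sub>F \<delta> in at_right 0. \<forall>\<tau>\<in>{s..t}. (\<xi> \<tau> + \<sigma> * \<delta>, \<tau>) \<in> S))"

lemma uniform_gap:
  fixes a b :: "real \<Rightarrow> real"
  assumes "continuous_on {0<..<T} a" "continuous_on {0<..<T} b"
    and "\<And>t. t \<in> {0<..<T} \<Longrightarrow> a t < b t" and "0 < s" "s \<le> t" "t < T"
  shows "\<forall>\<^sub>F \<delta> in at_right 0. \<forall>\<tau>\<in>{s..t}. a \<tau> + \<delta> < b \<tau>"
proof -
  have sub: "{s..t} \<subseteq> {0<..<T}" using assms by auto
  have "continuous_on {s..t} (\<lambda>\<tau>. b \<tau> - a \<tau>)"
    by (intro continuous_intros continuous_on_subset[OF assms(2) sub]
        continuous_on_subset[OF assms(1) sub])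
  then obtain m where m: "m \<in> {s..t}" "\<forall>\<tau>\<in>{s..t}. b m - a m \<le> b \<tau> - a \<tau>"
    using continuous_attains_inf[of "{s..t}" "\<lambda>\<tau>. b \<tau> - a \<tau>"] assms(5) by auto
  have "0 < b m - a m" using m(1) sub assms(3) by auto
  then have "\<forall>\<^sub>F \<delta> in at_right 0. \<delta> < b m - a m"
    using eventually_at_right_real[of 0 "b m - a m"] by (auto elim: eventually_mono)
  then show ?thesis
  proof (rule eventually_mono)
    fix \<delta> assume "\<delta> < b m - a m"
    show "\<forall>\<tau>\<in>{s..t}. a \<tau> + \<delta> < b \<tau>"
    proof
      fix \<tau> assume "\<tau> \<in> {s..t}"
      with m(2) have "b m - a m \<le> b \<tau> - a \<tau>" by blast
      with \<open>\<delta> < b m - a m\<close> show "a \<tau> + \<delta> < b \<tau>" by linarith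
    qed
  qed
qed

lemma strip_borders_edges:
  assumes "continuous_on (time_dom G) a" "continuous_on (time_dom G) b"
    and "\<And>t. t \<in> time_dom G \<Longrightarrow> a t < b t"
  shows "borders (horizon G) a 1 (strip G a b)" and "borders (horizon G) b (-1) (strip G a b)"
proof -
  have gap: "\<forall>\<^sub>F \<delta> in at_right 0. 0 < \<delta> \<and> (\<forall>\<tau>\<in>{s..t}. a \<tau> + \<delta> < b \<tau>)"
    if "0 < s" "s \<le> t" "t < horizon G" for s t
    by (intro eventually_conj eventually_at_right_less uniform_gap[of "horizon G"] that)
       (use assms in \<open>auto simp: time_dom_def\<close>)
  show "borders (horizon G) a 1 (strip G a b)"
    unfolding borders_def
    by (intro conjI allI impI eventually_mono[OF gap])
       (auto simp: strip_def time_dom_def)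
  show "borders (horizon G) b (-1) (strip G a b)"
    unfolding borders_def
    by (intro conjI allI impI eventually_mono[OF gap])
       (auto simp: strip_def time_dom_def field_simps)
qed

text \<open>Turns the filter of neighbourhoods of the origin in \<open>S\<close> into one threshold for both the time and
  the shift, which suits points given as shifts of points of the curve.\<close>

lemma near_curve_near_origin:
  fixes \<xi> :: "real \<Rightarrow> real" and \<sigma> :: real
  assumes "(\<xi> \<longlongrightarrow> 0) (at_right 0)" and "\<bar>\<sigma>\<bar> = 1"
    and "eventually P (at (0, 0) within S)"
  obtains r where "0 < r"
    and "\<And>\<tau> \<delta>. \<lbrakk>0 < \<tau>; \<tau> < r; 0 < \<delta>; \<delta> < r; (\<xi> \<tau> + \<sigma> * \<delta>, \<tau>) \<in> S\<rbrakk>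
      \<Longrightarrow> P (\<xi> \<tau> + \<sigma> * \<delta>, \<tau>)"
proof -
  obtain r where r: "r > 0" "\<And>z. \<lbrakk>z \<in> S; z \<noteq> (0, 0); dist z (0, 0) < r\<rbrakk> \<Longrightarrow> P z"
    using assms(3) unfolding eventually_at by blast
  have "\<forall>\<^sub>F \<tau> in at_right 0. \<bar>\<xi> \<tau>\<bar> < r / 3"
    using tendstoD[OF assms(1), of "r / 3"] r(1) by (simp add: dist_real_def)
  then obtain r' where r': "r' > 0" "\<And>\<tau>. \<lbrakk>0 < \<tau>; \<tau> < r'\<rbrakk> \<Longrightarrow> \<bar>\<xi> \<tau>\<bar> < r / 3"
    unfolding eventually_at_right_field by auto
  show ?thesis
  proof (rule that[of "min r' (r / 3)"])
    show "0 < min r' (r / 3)" using r r' by simp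
    fix \<tau> \<delta> assume h: "0 < \<tau>" "\<tau> < min r' (r / 3)" "0 < \<delta>" "\<delta> < min r' (r / 3)"
      and S: "(\<xi> \<tau> + \<sigma> * \<delta>, \<tau>) \<in> S"
    have "\<bar>\<sigma> * \<delta>\<bar> < r / 3" using h assms(2) by (simp add: abs_mult)
    moreover have "\<bar>\<xi> \<tau>\<bar> < r / 3" using r'(2) h by simp
    moreover have "dist (\<xi> \<tau> + \<sigma> * \<delta>, \<tau>) (0, 0) \<le> \<bar>\<xi> \<tau> + \<sigma> * \<delta>\<bar> + \<bar>\<tau>\<bar>"
      using norm_Pair_le[of "\<xi> \<tau> + \<sigma> * \<delta>" \<tau>] by (simp add: dist_norm flip: zero_prod_def)
    ultimately have "dist (\<xi> \<tau> + \<sigma> * \<delta>, \<tau>) (0, 0) < r" using h by linarith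
    then show "P (\<xi> \<tau> + \<sigma> * \<delta>, \<tau>)" using r(2)[OF S] h by auto
  qed
qed

lemma filterlim_shift_to_curve:
  assumes "\<bar>\<sigma>\<bar> = (1::real)"
  shows "filterlim (\<lambda>\<delta>. x + \<sigma> * \<delta>) (at x) (at_right 0)"
  unfolding filterlim_at
proof
  have "\<sigma> \<noteq> 0" using assms by auto
  have "\<forall>\<^sub>F \<delta>::real in at_right 0. 0 < \<delta>" by (rule eventually_at_right_less)
  then show "\<forall>\<^sub>F \<delta> in at_right 0. x + \<sigma> * \<delta> \<in> UNIV \<and> x + \<sigma> * \<delta> \<noteq> x"
    by eventually_elim (use \<open>\<sigma> \<noteq> 0\<close> in auto)
  show "((\<lambda>\<delta>. x + \<sigma> * \<delta>) \<longlongrightarrow> x) (at_right 0)"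
    by (auto intro!: tendsto_eq_intros)
qed

text \<open>Applied to the characteristic speed, this identifies the initial speed of a shear curve
  with \<open>lambda2\<close> or \<open>lambda5\<close>.\<close>

lemma trace_tendsto_origin_limit:
  assumes "0 < T" and \<xi>0: "(\<xi> \<longlongrightarrow> 0) (at_right 0)" and bd: "borders T \<xi> \<sigma> S"
    and F: "(F \<longlongrightarrow> l) (at (0, 0) within S)"
    and tr: "\<And>t. t \<in> {0<..<T} \<Longrightarrow> ((\<lambda>x. F (x, t)) \<longlongrightarrow> g t) (at (\<xi> t))"
  shows "(g \<longlongrightarrow> (l::real)) (at_right 0)"
proof (rule tendstoI)
  fix e :: real assume "0 < e"
  have \<sigma>: "\<bar>\<sigma>\<bar> = 1" using bd by (simp add: borders_def)
  have "\<forall>\<^sub>F z in at (0, 0) within S. dist (F z) l < e / 2"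
    using tendstoD[OF F, of "e / 2"] \<open>0 < e\<close> by simp
  then obtain r where r: "0 < r"
    "\<And>\<tau> \<delta>. \<lbrakk>0 < \<tau>; \<tau> < r; 0 < \<delta>; \<delta> < r; (\<xi> \<tau> + \<sigma> * \<delta>, \<tau>) \<in> S\<rbrakk>
      \<Longrightarrow> dist (F (\<xi> \<tau> + \<sigma> * \<delta>, \<tau>)) l < e / 2"
    using near_curve_near_origin[OF \<xi>0 \<sigma>] by metis
  have "dist (g t) l < e" if t: "0 < t" "t < r" "t < T" for t
  proof -
    have "((\<lambda>\<delta>. F (\<xi> t + \<sigma> * \<delta>, t)) \<longlongrightarrow> g t) (at_right 0)"
      by (rule filterlim_compose[OF tr filterlim_shift_to_curve[OF \<sigma>]]) (use t in simp)
    then have lim: "((\<lambda>\<delta>. dist (F (\<xi> t + \<sigma> * \<delta>, t)) l) \<longlongrightarrow> dist (g t) l) (at_right 0)"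
      by (intro tendsto_intros)
    have "\<forall>\<^sub>F \<delta> in at_right 0. \<forall>\<tau>\<in>{t..t}. (\<xi> \<tau> + \<sigma> * \<delta>, \<tau>) \<in> S"
      using bd t unfolding borders_def by blast
    moreover have "\<forall>\<^sub>F \<delta> in at_right 0. \<delta> \<in> {0<..<r}"
      by (rule eventually_at_right_real[OF r(1)])
    ultimately have "\<forall>\<^sub>F \<delta> in at_right 0. dist (F (\<xi> t + \<sigma> * \<delta>, t)) l \<le> e / 2"
    proof eventually_elim
      case (elim \<delta>)
      then show ?case using r(2)[of t \<delta>] t by simp
    qed
    then have "dist (g t) l \<le> e / 2"
      by (intro tendsto_upperbound[OF lim]) simp_all
    then show ?thesis using \<open>0 < e\<close> by simp
  qed
  then show "\<forall>\<^sub>F t in at_right 0. dist (g t) l < e"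
    using eventually_at_right_real[of 0 "min r T"] r(1) \<open>0 < T\<close> by (auto elim!: eventually_mono)
qed

text \<open>The trace \<open>g\<close> of \<open>f\<close> on the curve is a pointwise limit of \<open>h \<delta> t = f (\<xi> t + \<sigma> \<delta>, t)\<close>, which for
  small \<open>\<delta>\<close> is differentiable between \<open>t / 2\<close> and \<open>t\<close>. By the mean value theorem the
  difference quotient of \<open>h \<delta>\<close> is a value of \<open>\<partial>\<^sub>t f + \<xi>' \<partial>\<^sub>x f\<close> near the origin, hence close to
  \<open>q + v p\<close> uniformly in \<open>\<delta>\<close>, and the estimate survives \<open>\<delta> \<rightarrow> 0\<close>. The quotient is taken between
  \<open>t / 2\<close> and \<open>t\<close> rather than between 0 and \<open>t\<close>, because a shifted arc that reaches time 0 need not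
  stay inside \<open>S\<close>.\<close>

lemma trace_difference_quotient:
  fixes f :: "real \<times> real \<Rightarrow> real"
  assumes T: "0 < T" and \<xi>0: "(\<xi> \<longlongrightarrow> 0) (at_right 0)" and bd: "borders T \<xi> \<sigma> S"
    and \<xi>': "\<And>t. t \<in> {0<..<T} \<Longrightarrow> (\<xi> has_real_derivative \<xi>' t) (at t)"
    and sp: "(\<xi>' \<longlongrightarrow> v) (at_right 0)"
    and diff: "\<And>z. z \<in> S \<Longrightarrow> f differentiable (at z)"
    and fx: "(dx f \<longlongrightarrow> p) (at (0, 0) within S)" and ft: "(dt f \<longlongrightarrow> q) (at (0, 0) within S)"
    and tr: "\<And>t. t \<in> {0<..<T} \<Longrightarrow> ((\<lambda>x. f (x, t)) \<longlongrightarrow> g t) (at (\<xi> t))"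
  shows "((\<lambda>t. (g t - g (t / 2)) / (t / 2)) \<longlongrightarrow> q + v * p) (at_right 0)"
proof (rule tendstoI)
  fix e :: real assume "0 < e"
  have \<sigma>: "\<bar>\<sigma>\<bar> = 1" using bd by (simp add: borders_def)
  \<comment> \<open>The slope of the curve and the partial derivatives of \<open>f\<close> are evaluated at independent points;
    the product filter separates the smallness conditions on the two.\<close>
  let ?A = "at_right 0 \<times>\<^sub>F (at (0, 0) within S)"
  have "((\<lambda>w. dt f (snd w) + \<xi>' (fst w) * dx f (snd w)) \<longlongrightarrow> q + v * p) ?A"
    by (intro tendsto_intros filterlim_compose[OF sp filterlim_fst]
        filterlim_compose[OF fx filterlim_snd] filterlim_compose[OF ft filterlim_snd])
  then have "\<forall>\<^sub>F w in ?A. dist (dt f (snd w) + \<xi>' (fst w) * dx f (snd w)) (q + v * p) < e / 2"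
    using \<open>0 < e\<close> by (intro tendstoD) auto
  then obtain P Q where PQ: "eventually P (at_right 0)" "eventually Q (at (0, 0) within S)"
    "\<And>\<tau> z. \<lbrakk>P \<tau>; Q z\<rbrakk> \<Longrightarrow> dist (dt f z + \<xi>' \<tau> * dx f z) (q + v * p) < e / 2"
    unfolding eventually_prod_filter by auto
  obtain r where r: "0 < r"
    "\<And>\<tau> \<delta>. \<lbrakk>0 < \<tau>; \<tau> < r; 0 < \<delta>; \<delta> < r; (\<xi> \<tau> + \<sigma> * \<delta>, \<tau>) \<in> S\<rbrakk>
      \<Longrightarrow> Q (\<xi> \<tau> + \<sigma> * \<delta>, \<tau>)"
    using near_curve_near_origin[OF \<xi>0 \<sigma> PQ(2)] by metis
  obtain r' where r': "r' > 0" "\<And>\<tau>. \<lbrakk>0 < \<tau>; \<tau> < r'\<rbrakk> \<Longrightarrow> P \<tau>"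
    using PQ(1) unfolding eventually_at_right_field by auto
  have "dist ((g t - g (t / 2)) / (t / 2)) (q + v * p) < e"
    if t: "0 < t" "t < min r (min r' T)" for t
  proof -
    define h where "h \<delta> \<tau> = f (\<xi> \<tau> + \<sigma> * \<delta>, \<tau>)" for \<delta> \<tau>
    have hlim: "((\<lambda>\<delta>. h \<delta> \<tau>) \<longlongrightarrow> g \<tau>) (at_right 0)" if "\<tau> \<in> {0<..<T}" for \<tau>
      unfolding h_def
      by (rule filterlim_compose[OF tr[OF that] filterlim_shift_to_curve[OF \<sigma>]])
    have lim: "((\<lambda>\<delta>. dist ((h \<delta> t - h \<delta> (t / 2)) / (t / 2)) (q + v * p)) \<longlongrightarrow>
        dist ((g t - g (t / 2)) / (t / 2)) (q + v * p)) (at_right 0)"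
      by (intro tendsto_intros hlim) (use t in auto)
    have "\<forall>\<^sub>F \<delta> in at_right 0. \<forall>\<tau>\<in>{t/2..t}. (\<xi> \<tau> + \<sigma> * \<delta>, \<tau>) \<in> S"
      using bd t unfolding borders_def by simp
    moreover have "\<forall>\<^sub>F \<delta> in at_right 0. \<delta> \<in> {0<..<r}"
      by (rule eventually_at_right_real[OF r(1)])
    ultimately have "\<forall>\<^sub>F \<delta> in at_right 0.
        dist ((h \<delta> t - h \<delta> (t / 2)) / (t / 2)) (q + v * p) \<le> e / 2"
    proof eventually_elim
      case (elim \<delta>)
      have D: "(h \<delta> has_real_derivative
          dt f (\<xi> \<tau> + \<sigma> * \<delta>, \<tau>) + \<xi>' \<tau> * dx f (\<xi> \<tau> + \<sigma> * \<delta>, \<tau>)) (at \<tau>)"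
        if "t / 2 \<le> \<tau>" "\<tau> \<le> t" for \<tau>
      proof -
        have "(\<xi> has_derivative (\<lambda>k. \<xi>' \<tau> * k)) (at \<tau>)"
          using \<xi>'[of \<tau>] that t unfolding has_field_derivative_def by simp
        then have "((\<lambda>\<tau>. (\<xi> \<tau> + \<sigma> * \<delta>, \<tau>)) has_derivative (\<lambda>k. (\<xi>' \<tau> * k, k))) (at \<tau>)"
          by (auto intro!: derivative_eq_intros)
        from has_derivative_compose[OF this
            differentiable_imp_has_derivative_partials[OF diff]] elim(1) that
        have "(h \<delta> has_derivative (\<lambda>k. \<xi>' \<tau> * k * dx f (\<xi> \<tau> + \<sigma> * \<delta>, \<tau>)
            + k * dt f (\<xi> \<tau> + \<sigma> * \<delta>, \<tau>))) (at \<tau>)"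
          unfolding h_def by simp
        then show ?thesis
          unfolding has_field_derivative_def
          by (rule has_derivative_eq_rhs) (simp add: fun_eq_iff algebra_simps)
      qed
      obtain \<tau> where \<tau>: "t / 2 < \<tau>" "\<tau> < t" "h \<delta> t - h \<delta> (t / 2) = (t - t / 2) *
          (dt f (\<xi> \<tau> + \<sigma> * \<delta>, \<tau>) + \<xi>' \<tau> * dx f (\<xi> \<tau> + \<sigma> * \<delta>, \<tau>))"
        using MVT2[of "t / 2" t "h \<delta>"] D t by force
      have "(h \<delta> t - h \<delta> (t / 2)) / (t / 2) =
          dt f (\<xi> \<tau> + \<sigma> * \<delta>, \<tau>) + \<xi>' \<tau> * dx f (\<xi> \<tau> + \<sigma> * \<delta>, \<tau>)"
        unfolding \<tau>(3) using t by simp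
      moreover have "Q (\<xi> \<tau> + \<sigma> * \<delta>, \<tau>)"
        by (rule r(2)) (use elim \<tau> t in auto)
      moreover have "P \<tau>" by (rule r'(2)) (use \<tau> t in auto)
      ultimately show ?case using PQ(3) by (simp add: less_imp_le)
    qed
    then have "dist ((g t - g (t / 2)) / (t / 2)) (q + v * p) \<le> e / 2"
      by (intro tendsto_upperbound[OF lim]) simp_all
    then show ?thesis using \<open>0 < e\<close> by simp
  qed
  then show "\<forall>\<^sub>F t in at_right 0. dist ((g t - g (t / 2)) / (t / 2)) (q + v * p) < e"
    using eventually_at_right_real[of 0 "min r (min r' T)"] r(1) r'(1) T
    by (auto elim!: eventually_mono)
qed

text \<open>Both sides of the curve see the same trace, hence the same difference quotients.\<close>

lemma one_sided_derivatives_agree: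
  fixes f :: "real \<times> real \<Rightarrow> real"
  assumes T: "0 < T" and \<xi>0: "(\<xi> \<longlongrightarrow> 0) (at_right 0)"
    and bd: "borders T \<xi> \<sigma> S" "borders T \<xi> \<sigma>' S'"
    and \<xi>': "\<And>t. t \<in> {0<..<T} \<Longrightarrow> (\<xi> has_real_derivative \<xi>' t) (at t)"
    and sp: "(\<xi>' \<longlongrightarrow> v) (at_right 0)"
    and diff: "\<And>z. z \<in> S \<Longrightarrow> f differentiable (at z)" "\<And>z. z \<in> S' \<Longrightarrow> f differentiable (at z)"
    and lims: "(dx f \<longlongrightarrow> p) (at (0, 0) within S)" "(dt f \<longlongrightarrow> q) (at (0, 0) within S)"
      "(dx f \<longlongrightarrow> p') (at (0, 0) within S')" "(dt f \<longlongrightarrow> q') (at (0, 0) within S')"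
    and tr: "\<And>t. t \<in> {0<..<T} \<Longrightarrow> \<exists>l. ((\<lambda>x. f (x, t)) \<longlongrightarrow> l) (at (\<xi> t))"
  shows "q + v * p = q' + v * p'"
proof -
  obtain g where g: "\<And>t. t \<in> {0<..<T} \<Longrightarrow> ((\<lambda>x. f (x, t)) \<longlongrightarrow> g t) (at (\<xi> t))"
    using tr by metis
  show ?thesis
    by (rule tendsto_unique[OF trivial_limit_at_right_real
          trace_difference_quotient[OF T \<xi>0 bd(1) \<xi>' sp diff(1) lims(1,2) g]
          trace_difference_quotient[OF T \<xi>0 bd(2) \<xi>' sp diff(2) lims(3,4) g]])
qed

section \<open>Limits at the origin inside a region\<close>

lemma components_members [simp]:
  "rho \<in> components" "u1 \<in> components" "u2 \<in> components"
  "p11 \<in> components" "p12 \<in> components" "p22 \<in> components"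
  by (auto simp: components_def)

lemma lim_state_component: "q \<in> components \<Longrightarrow> q (lim_state G K) = origin_lim G K (q \<circ> sol G)"
  by (auto simp: components_def lim_state_def)

lemma strip_accumulates_at_origin:
  assumes "0 < horizon G" "(a \<longlongrightarrow> 0) (at_right 0)" "(b \<longlongrightarrow> 0) (at_right 0)"
    and "\<And>t. t \<in> time_dom G \<Longrightarrow> a t < b t"
  shows "at (0, 0) within strip G a b \<noteq> bot"
proof
  assume bot: "at (0, 0) within strip G a b = bot"
  have "((\<lambda>t. ((a t + b t) / 2, t)) \<longlongrightarrow> (0, 0)) (at_right 0)"
    using assms(2,3) by (auto intro!: tendsto_eq_intros)
  moreover have "\<forall>\<^sub>F t in at_right 0. ((a t + b t) / 2, t) \<in> strip G a b \<and> ((a t + b t) / 2, t) \<noteq> (0, 0)"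
    using eventually_at_right_real[OF assms(1)]
  proof eventually_elim
    case (elim t)
    with assms(4)[of t] show ?case by (simp add: strip_def time_dom_def)
  qed
  ultimately have "filterlim (\<lambda>t. ((a t + b t) / 2, t)) (at (0, 0) within strip G a b) (at_right 0)"
    unfolding filterlim_at by simp
  then show False unfolding bot filterlim_iff
    using trivial_limit_at_right_real[of 0] by (auto simp: trivial_limit_def)
qed

text \<open>Makes limits at the origin within a zone unique, so that \<open>origin_lim\<close> is the actual limit.\<close>

lemma zone_accumulates_at_origin:
  assumes "grp_solution G"
  shows "at (0, 0) within zone G K \<noteq> bot"
  using assms unfolding grp_solution_def wave_pattern_def
  by (cases K; simp only: zone.simps; intro strip_accumulates_at_origin) auto

lemma shear_speed_eq:
  assumes "0 < rho s" "0 < p11 s"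
  shows "c_speed s / sqrt 3 = p11 s / sqrt (rho s * p11 s)"
proof -
  have "c_speed s / sqrt 3 = sqrt (p11 s) / sqrt (rho s)"
    by (simp add: c_speed_def real_sqrt_divide real_sqrt_mult)
  also have "\<dots> = p11 s / sqrt (rho s * p11 s)"
    using assms by (simp add: real_sqrt_mult field_simps)
  finally show ?thesis .
qed

context
  fixes G :: grp
  assumes G: "grp_solution G"
begin

lemma tendsto_components:
  assumes "q \<in> components"
  shows "((\<lambda>z. q (sol G z)) \<longlongrightarrow> q (lim_state G K)) (at (0, 0) within zone G K)"
    and "(dx (q \<circ> sol G) \<longlongrightarrow> origin_lim G K (dx (q \<circ> sol G))) (at (0, 0) within zone G K)"
    and "(dt (q \<circ> sol G) \<longlongrightarrow> origin_lim G K (dt (q \<circ> sol G))) (at (0, 0) within zone G K)"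
proof -
  have *: "(f \<longlongrightarrow> origin_lim G K f) (at (0, 0) within zone G K)" if "has_lim G K f" for f
    using that tendsto_Lim[OF zone_accumulates_at_origin[OF G, of K]]
    unfolding has_lim_def origin_lim_def by blast
  have "has_lim G K (q \<circ> sol G) \<and> has_lim G K (dx (q \<circ> sol G)) \<and> has_lim G K (dt (q \<circ> sol G))"
    using G assms unfolding grp_solution_def limits_exist_def by blast
  then show "((\<lambda>z. q (sol G z)) \<longlongrightarrow> q (lim_state G K)) (at (0, 0) within zone G K)"
    and "(dx (q \<circ> sol G) \<longlongrightarrow> origin_lim G K (dx (q \<circ> sol G))) (at (0, 0) within zone G K)"
    and "(dt (q \<circ> sol G) \<longlongrightarrow> origin_lim G K (dt (q \<circ> sol G))) (at (0, 0) within zone G K)"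
    using * assms by (auto simp: lim_state_component comp_def)
qed

lemma origin_lim_eqI:
  "(f \<longlongrightarrow> l) (at (0, 0) within zone G K) \<Longrightarrow> origin_lim G K f = l"
  unfolding origin_lim_def using zone_accumulates_at_origin[OF G] by (rule tendsto_Lim)

lemma origin_lim_directional:
  assumes "q \<in> components"
  shows "origin_lim G K (\<lambda>z. dt (q \<circ> sol G) z + v * dx (q \<circ> sol G) z) =
    origin_lim G K (dt (q \<circ> sol G)) + v * origin_lim G K (dx (q \<circ> sol G))"
  by (intro origin_lim_eqI tendsto_intros tendsto_components assms)

lemma lim_material_eq:
  assumes "q \<in> components"
  shows "lim_material G K q =
    origin_lim G K (dt (q \<circ> sol G)) + u1 (lim_state G K) * origin_lim G K (dx (q \<circ> sol G))"
  unfolding lim_material_def material_def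
  by (intro origin_lim_eqI tendsto_intros tendsto_components assms) simp

lemma tendsto_material:
  assumes "q \<in> components"
  shows "(material (sol G) q \<longlongrightarrow> lim_material G K q) (at (0, 0) within zone G K)"
  unfolding lim_material_eq[OF assms] unfolding material_def
  by (intro tendsto_intros tendsto_components assms) simp

lemma zone_smooth:
  assumes "z \<in> zone G K"
  shows "admissible (sol G z)" and "ten_moment_eqs (potential G) (sol G) z"
    and "q \<in> components \<Longrightarrow> (q \<circ> sol G) differentiable (at z)"
proof -
  have "smooth_solution_on (potential G) (sol G) (zone G K)"
    using G unfolding grp_solution_def by blast
  then show "admissible (sol G z)" and "ten_moment_eqs (potential G) (sol G) z"
    and "q \<in> components \<Longrightarrow> (q \<circ> sol G) differentiable (at z)"
    using assms unfolding smooth_solution_on_def C1_on_def by blast+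
qed

lemma lim_state_pos: "0 < rho (lim_state G K)" "0 < p11 (lim_state G K)"
  using G unfolding grp_solution_def common_limits_def admissible_def by blast+

lemma eventually_in_zone: "\<forall>\<^sub>F z in at (0, 0) within zone G K. z \<in> zone G K"
  by (simp add: eventually_at_filter)

lemma limit_equation:
  assumes "(f \<longlongrightarrow> l) (at (0, 0) within zone G K)" "\<And>z. z \<in> zone G K \<Longrightarrow> f z = 0"
  shows "l = (0::real)"
proof -
  have "(f \<longlongrightarrow> 0) (at (0, 0) within zone G K)"
    by (rule tendsto_eventually, rule eventually_mono[OF eventually_in_zone]) (rule assms(2))
  then show ?thesis
    using tendsto_unique[OF zone_accumulates_at_origin[OF G] assms(1)] by blast
qed

lemma limit_equations:
  shows "lim_material G K u2 + 1 / rho (lim_state G K) * origin_lim G K (dx (p12 \<circ> sol G)) = 0"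
    and "lim_material G K p11 + 3 * p11 (lim_state G K) * origin_lim G K (dx (u1 \<circ> sol G)) = 0"
    and "lim_material G K p12 + 2 * p12 (lim_state G K) * origin_lim G K (dx (u1 \<circ> sol G))
      + p11 (lim_state G K) * origin_lim G K (dx (u2 \<circ> sol G)) = 0"
proof -
  have eq: "ten_moment_eqs (potential G) (sol G) z" if "z \<in> zone G K" for z
    using zone_smooth(2)[OF that] .
  have "((\<lambda>z. material (sol G) u2 z + 1 / rho (sol G z) * dx (p12 \<circ> sol G) z) \<longlongrightarrow>
      lim_material G K u2 + 1 / rho (lim_state G K) * origin_lim G K (dx (p12 \<circ> sol G)))
      (at (0, 0) within zone G K)"
    by (intro tendsto_intros tendsto_components tendsto_material)
       (use lim_state_pos(1)[of K] in auto)
  then show "lim_material G K u2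
      + 1 / rho (lim_state G K) * origin_lim G K (dx (p12 \<circ> sol G)) = 0"
    by (rule limit_equation) (use eq in \<open>simp add: ten_moment_eqs_def\<close>)
  have "((\<lambda>z. material (sol G) p11 z + 3 * p11 (sol G z) * dx (u1 \<circ> sol G) z) \<longlongrightarrow>
      lim_material G K p11 + 3 * p11 (lim_state G K) * origin_lim G K (dx (u1 \<circ> sol G)))
      (at (0, 0) within zone G K)"
    by (intro tendsto_intros tendsto_components tendsto_material) auto
  then show "lim_material G K p11
      + 3 * p11 (lim_state G K) * origin_lim G K (dx (u1 \<circ> sol G)) = 0"
    by (rule limit_equation) (use eq in \<open>simp add: ten_moment_eqs_def\<close>)
  have "((\<lambda>z. material (sol G) p12 z + 2 * p12 (sol G z) * dx (u1 \<circ> sol G) z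
      + p11 (sol G z) * dx (u2 \<circ> sol G) z) \<longlongrightarrow>
      lim_material G K p12 + 2 * p12 (lim_state G K) * origin_lim G K (dx (u1 \<circ> sol G))
      + p11 (lim_state G K) * origin_lim G K (dx (u2 \<circ> sol G)))
      (at (0, 0) within zone G K)"
    by (intro tendsto_intros tendsto_components tendsto_material) auto
  then show "lim_material G K p12 + 2 * p12 (lim_state G K) * origin_lim G K (dx (u1 \<circ> sol G))
      + p11 (lim_state G K) * origin_lim G K (dx (u2 \<circ> sol G)) = 0"
    by (rule limit_equation) (use eq in \<open>simp add: ten_moment_eqs_def\<close>)
qed

text \<open>The equations for \<open>u\<^sub>2\<close> and \<open>p\<^sub>1\<^sub>2\<close>, solved for the \<open>x\<close>-derivatives; \<open>\<partial>\<^sub>x u\<^sub>1\<close> is eliminated by the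
  equation for \<open>p\<^sub>1\<^sub>1\<close>.\<close>

lemma limit_space_derivatives:
  shows "origin_lim G K (dx (p12 \<circ> sol G)) = - rho (lim_state G K) * lim_material G K u2"
    and "origin_lim G K (dx (u2 \<circ> sol G)) = - (lim_material G K p12
      - 2 * p12 (lim_state G K) / (3 * p11 (lim_state G K)) * lim_material G K p11)
      / p11 (lim_state G K)"
proof -
  note pos = lim_state_pos[of K]
  show "origin_lim G K (dx (p12 \<circ> sol G)) = - rho (lim_state G K) * lim_material G K u2"
    using limit_equations(1)[of K] pos by (simp add: field_simps)
  have "origin_lim G K (dx (u1 \<circ> sol G)) = - lim_material G K p11 / (3 * p11 (lim_state G K))"
    using limit_equations(2)[of K] pos by (simp add: field_simps)
  moreover have "origin_lim G K (dx (u2 \<circ> sol G)) = - (lim_material G K p12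
      + 2 * p12 (lim_state G K) * origin_lim G K (dx (u1 \<circ> sol G))) / p11 (lim_state G K)"
    using limit_equations(3)[of K] pos by (simp add: field_simps)
  ultimately show "origin_lim G K (dx (u2 \<circ> sol G)) = - (lim_material G K p12
      - 2 * p12 (lim_state G K) / (3 * p11 (lim_state G K)) * lim_material G K p11)
      / p11 (lim_state G K)"
    by simp
qed

lemma limit_time_derivatives:
  shows "origin_lim G K (dt (u2 \<circ> sol G)) = lim_material G K u2
      + u1 (lim_state G K) / p11 (lim_state G K) * (lim_material G K p12
        - 2 * p12 (lim_state G K) / (3 * p11 (lim_state G K)) * lim_material G K p11)"
    and "origin_lim G K (dt (p12 \<circ> sol G)) = lim_material G K p12
      + rho (lim_state G K) * u1 (lim_state G K) * lim_material G K u2"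
proof -
  have *: "origin_lim G K (dt (q \<circ> sol G)) =
      lim_material G K q - u1 (lim_state G K) * origin_lim G K (dx (q \<circ> sol G))"
    if "q \<in> components" for q
    using lim_material_eq[OF that, of K] by simp
  show "origin_lim G K (dt (u2 \<circ> sol G)) = lim_material G K u2
      + u1 (lim_state G K) / p11 (lim_state G K) * (lim_material G K p12
        - 2 * p12 (lim_state G K) / (3 * p11 (lim_state G K)) * lim_material G K p11)"
    unfolding *[OF components_members(3)] limit_space_derivatives
    by (simp only: minus_divide_left[symmetric]) simp
  show "origin_lim G K (dt (p12 \<circ> sol G)) = lim_material G K p12
      + rho (lim_state G K) * u1 (lim_state G K) * lim_material G K u2"
    unfolding *[OF components_members(5)] limit_space_derivatives by simp
qed

section \<open>The linear equation contributed by a shear curve\<close>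

lemma shear_invariant_derivative:
  fixes \<sigma> :: real
  defines "f \<equiv> (\<lambda>s. u2 s + \<sigma> * p12 s / sqrt (rho s * p11 s)) \<circ> sol G"
  assumes z: "z \<in> zone G K"
  defines "s \<equiv> sol G z"
  shows "f differentiable (at z)"
    and "dx f z = dx (u2 \<circ> sol G) z + \<sigma> / sqrt (rho s * p11 s) * (dx (p12 \<circ> sol G) z
      - p12 s / 2 * (dx (rho \<circ> sol G) z / rho s + dx (p11 \<circ> sol G) z / p11 s))"
    and "dt f z = dt (u2 \<circ> sol G) z + \<sigma> / sqrt (rho s * p11 s) * (dt (p12 \<circ> sol G) z
      - p12 s / 2 * (dt (rho \<circ> sol G) z / rho s + dt (p11 \<circ> sol G) z / p11 s))"
proof -
  have pos: "0 < rho s" "0 < p11 s"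
    using zone_smooth(1)[OF z] by (auto simp: admissible_def s_def)
  have D: "((\<lambda>z. q (sol G z)) has_derivative
      (\<lambda>w. fst w * dx (q \<circ> sol G) z + snd w * dt (q \<circ> sol G) z)) (at z)" if "q \<in> components" for q
    using differentiable_imp_has_derivative_partials[OF zone_smooth(3)[OF z that]]
    by (simp add: comp_def)
  define R where "R = sqrt (rho s * p11 s)"
  have R: "R > 0" "R\<^sup>2 = rho s * p11 s" using pos by (auto simp: R_def)
  have "((\<lambda>z. u2 (sol G z) + \<sigma> * p12 (sol G z) / sqrt (rho (sol G z) * p11 (sol G z)))
      has_derivative (\<lambda>w. fst w * dx (u2 \<circ> sol G) z + snd w * dt (u2 \<circ> sol G) z
        + (\<sigma> * (fst w * dx (p12 \<circ> sol G) z + snd w * dt (p12 \<circ> sol G) z) * R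
          - \<sigma> * p12 s * ((rho s * (fst w * dx (p11 \<circ> sol G) z + snd w * dt (p11 \<circ> sol G) z)
            + (fst w * dx (rho \<circ> sol G) z + snd w * dt (rho \<circ> sol G) z) * p11 s)
             * (inverse R / 2))) / (R * R))) (at z)"
    (is "(_ has_derivative ?E) _")
    using pos unfolding s_def R_def
    by (auto intro!: derivative_eq_intros D)
  also have "?E =
     (\<lambda>w. fst w * (dx (u2 \<circ> sol G) z + \<sigma> / R * (dx (p12 \<circ> sol G) z
        - p12 s / 2 * (dx (rho \<circ> sol G) z / rho s + dx (p11 \<circ> sol G) z / p11 s)))
      + snd w * (dt (u2 \<circ> sol G) z + \<sigma> / R * (dt (p12 \<circ> sol G) z
        - p12 s / 2 * (dt (rho \<circ> sol G) z / rho s + dt (p11 \<circ> sol G) z / p11 s))))"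
    (is "_ = ?D")
  proof -
    have split: "(A * R - B * (C * (inverse R / 2))) / (R * R)
      = 1 / R * (A - B / 2 * (C / (rho s * p11 s)))" for A B C
      unfolding R(2)[symmetric] using R(1) by (simp add: field_simps power2_eq_square)
    have quot: "(rho s * C + E * p11 s) / (rho s * p11 s) = E / rho s + C / p11 s" for C E
      using pos by (simp add: field_simps)
    show ?thesis
      unfolding split quot
      by (rule ext) (simp add: algebra_simps add_divide_distrib)
  qed
  finally have F: "(f has_derivative ?D) (at z)"
    unfolding f_def by (simp add: comp_def)
  show "f differentiable (at z)" using F by (rule differentiableI)
  show "dx f z = dx (u2 \<circ> sol G) z + \<sigma> / sqrt (rho s * p11 s) * (dx (p12 \<circ> sol G) z
      - p12 s / 2 * (dx (rho \<circ> sol G) z / rho s + dx (p11 \<circ> sol G) z / p11 s))"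
    using has_derivative_imp_partials(1)[OF F] by (simp add: R_def)
  show "dt f z = dt (u2 \<circ> sol G) z + \<sigma> / sqrt (rho s * p11 s) * (dt (p12 \<circ> sol G) z
      - p12 s / 2 * (dt (rho \<circ> sol G) z / rho s + dt (p11 \<circ> sol G) z / p11 s))"
    using has_derivative_imp_partials(2)[OF F] by (simp add: R_def)
qed

text \<open>One linear equation for the material derivatives in the inner zone \<open>K'\<close>, with data from the outer
  zone \<open>K\<close>. The sign \<open>\<sigma>\<close> covers the 2-shear curve (\<open>\<sigma> = 1\<close>: the inner zone is to the right) and
  its mirror image, the 5-shear curve (\<open>\<sigma> = -1\<close>), at once.\<close>

lemma shear_relation:
  fixes \<sigma> :: real
  defines "f \<equiv> \<lambda>s. u2 s + \<sigma> * p12 s / sqrt (rho s * p11 s)"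
  assumes \<xi>0: "(\<xi> \<longlongrightarrow> 0) (at_right 0)"
    and outer: "borders (horizon G) \<xi> (- \<sigma>) (zone G K)"
    and inner: "borders (horizon G) \<xi> \<sigma> (zone G K')"
    and speed: "moves_with G \<xi> (\<lambda>s. u1 s - \<sigma> * (c_speed s / sqrt 3))"
    and invariants: "continuous_across G rho \<xi>" "continuous_across G p11 \<xi>"
      "continuous_across G f \<xi>"
    and rho': "rho (lim_state G K') = rho (lim_state G K)"
  defines "r \<equiv> rho (lim_state G K)" and "p \<equiv> p11 (lim_state G K)"
    and "\<Delta> \<equiv> \<sigma> * (p12 (lim_state G K') - p12 (lim_state G K))"
    and "v \<equiv> u1 (lim_state G K) - \<sigma> * (c_speed (lim_state G K) / sqrt 3)"
  defines "D \<equiv> \<lambda>q. origin_lim G K (\<lambda>z. dt (q \<circ> sol G) z + v * dx (q \<circ> sol G) z)"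
  shows "2 * lim_material G K' u2 + \<sigma> * (2 / sqrt (r * p)) * lim_material G K' p12 =
    \<Delta> / (2 * r * sqrt (r * p)) * D rho + D u2 + \<Delta> / (2 * p * sqrt (r * p)) * D p11
    + \<sigma> / sqrt (r * p) * D p12
    - 2 * p12 (lim_state G K') * (v - u1 (lim_state G K)) / (3 * p\<^sup>2) * lim_material G K' p11"
proof -
  have T: "0 < horizon G" using G by (simp add: grp_solution_def)
  have pos: "0 < r" "0 < p" using lim_state_pos[of K] by (simp_all add: r_def p_def)
  define R where "R = sqrt (r * p)"
  have R: "0 < R" "R * R = r * p" using pos by (simp_all add: R_def)
  have \<sigma>: "\<sigma> * \<sigma> = 1" using inner abs_mult_self_eq[of \<sigma>] by (simp add: borders_def)
  have common: "u1 (lim_state G K') = u1 (lim_state G K)" "p11 (lim_state G K') = p"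
    using G unfolding grp_solution_def common_limits_def p_def by metis+
  have v: "v = u1 (lim_state G K) - \<sigma> * (p / R)"
    unfolding v_def R_def r_def p_def shear_speed_eq[OF lim_state_pos] ..
  let ?lx = "\<lambda>K q. origin_lim G K (dx (q \<circ> sol G))"
  let ?lt = "\<lambda>K q. origin_lim G K (dt (q \<circ> sol G))"

  let ?speed = "\<lambda>s. u1 s - \<sigma> * (c_speed s / sqrt 3)"
  have "\<forall>t\<in>{0<..<horizon G}. \<exists>s. ((\<lambda>x. ?speed (sol G (x, t))) \<longlongrightarrow> s) (at (\<xi> t))
      \<and> (\<xi> has_real_derivative s) (at t)"
    using speed unfolding moves_with_def time_dom_def by (rule conjunct2)
  from bchoice[OF this] obtain \<xi>' where
    "\<forall>t\<in>{0<..<horizon G}. ((\<lambda>x. ?speed (sol G (x, t))) \<longlongrightarrow> \<xi>' t) (at (\<xi> t))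
      \<and> (\<xi> has_real_derivative \<xi>' t) (at t)" ..
  then have \<xi>': "\<And>t. t \<in> {0<..<horizon G} \<Longrightarrow> ((\<lambda>x. ?speed (sol G (x, t))) \<longlongrightarrow> \<xi>' t) (at (\<xi> t))"
    "\<And>t. t \<in> {0<..<horizon G} \<Longrightarrow> (\<xi> has_real_derivative \<xi>' t) (at t)"
    by blast+
  have "((\<lambda>z. ?speed (sol G z)) \<longlongrightarrow> v) (at (0, 0) within zone G K)"
    unfolding v_def c_speed_def
    by (intro tendsto_intros tendsto_components) (use lim_state_pos(1)[of K] in auto)
  from trace_tendsto_origin_limit[OF T \<xi>0 outer this \<xi>'(1)]
  have \<xi>'lim: "(\<xi>' \<longlongrightarrow> v) (at_right 0)" .
  note agree = one_sided_derivatives_agree[OF T \<xi>0 outer inner \<xi>'(2) \<xi>'lim]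

  have same: "D q = ?lt K' q + v * ?lx K' q"
    if "continuous_across G q \<xi>" "q \<in> components" for q
  proof -
    have "?lt K q + v * ?lx K q = ?lt K' q + v * ?lx K' q"
    proof (rule agree)
      show "\<exists>l. ((\<lambda>x. (q \<circ> sol G) (x, t)) \<longlongrightarrow> l) (at (\<xi> t))" if "t \<in> {0<..<horizon G}" for t
        using \<open>continuous_across G q \<xi>\<close> that by (simp add: continuous_across_def time_dom_def)
    qed (assumption | rule zone_smooth(3) tendsto_components(2,3) that(2))+
    then show ?thesis unfolding D_def origin_lim_directional[OF that(2)] .
  qed

  \<comment> \<open>Limit of the partial derivative of \<open>f\<close> in zone \<open>J\<close>, given those of the components as \<open>l J\<close>.\<close>
  define lf where "lf l J = l J u2 + \<sigma> / R * (l J p12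
      - p12 (lim_state G J) / 2 * (l J rho / r + l J p11 / p))"
    for l :: "region \<Rightarrow> (state \<Rightarrow> real) \<Rightarrow> real" and J
  have f_limits: "(dx (f \<circ> sol G) \<longlongrightarrow> lf ?lx J) (at (0, 0) within zone G J)"
    "(dt (f \<circ> sol G) \<longlongrightarrow> lf ?lt J) (at (0, 0) within zone G J)"
    if J: "rho (lim_state G J) = r" "p11 (lim_state G J) = p" for J
  proof -
    show "(dx (f \<circ> sol G) \<longlongrightarrow> lf ?lx J) (at (0, 0) within zone G J)"
    proof (rule Lim_transform_eventually)
      show "\<forall>\<^sub>F z in at (0, 0) within zone G J.
          dx (u2 \<circ> sol G) z + \<sigma> / sqrt (rho (sol G z) * p11 (sol G z)) * (dx (p12 \<circ> sol G) z
            - p12 (sol G z) / 2 * (dx (rho \<circ> sol G) z / rho (sol G z)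
              + dx (p11 \<circ> sol G) z / p11 (sol G z))) = dx (f \<circ> sol G) z"
        unfolding f_def
        by (rule eventually_mono[OF eventually_in_zone]) (rule shear_invariant_derivative(2)[symmetric])
    qed (unfold lf_def R_def J[symmetric], intro tendsto_intros tendsto_components,
        use J pos in auto)
    show "(dt (f \<circ> sol G) \<longlongrightarrow> lf ?lt J) (at (0, 0) within zone G J)"
    proof (rule Lim_transform_eventually)
      show "\<forall>\<^sub>F z in at (0, 0) within zone G J.
          dt (u2 \<circ> sol G) z + \<sigma> / sqrt (rho (sol G z) * p11 (sol G z)) * (dt (p12 \<circ> sol G) z
            - p12 (sol G z) / 2 * (dt (rho \<circ> sol G) z / rho (sol G z)
              + dt (p11 \<circ> sol G) z / p11 (sol G z))) = dt (f \<circ> sol G) z"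
        unfolding f_def
        by (rule eventually_mono[OF eventually_in_zone]) (rule shear_invariant_derivative(3)[symmetric])
    qed (unfold lf_def R_def J[symmetric], intro tendsto_intros tendsto_components,
        use J pos in auto)
  qed
  have f_diff: "(f \<circ> sol G) differentiable (at z)" if "z \<in> zone G J" for z J
    unfolding f_def by (rule shear_invariant_derivative(1)[OF that])
  have state: "rho (lim_state G K) = r" "p11 (lim_state G K) = p"
    "rho (lim_state G K') = r" "p11 (lim_state G K') = p"
    using rho' common(2) by (simp_all add: r_def p_def)
  have f_same: "lf ?lt K + v * lf ?lx K = lf ?lt K' + v * lf ?lx K'"
  proof (rule agree)
    show "\<exists>l. ((\<lambda>x. (f \<circ> sol G) (x, t)) \<longlongrightarrow> l) (at (\<xi> t))" if "t \<in> {0<..<horizon G}" for t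
      using invariants(3) that by (simp add: continuous_across_def time_dom_def)
  qed (assumption | rule f_diff f_limits state | rule refl)+

  have dir: "lf ?lt J + v * lf ?lx J = (?lt J u2 + v * ?lx J u2) + \<sigma> / R * ((?lt J p12 + v * ?lx J p12)
      - p12 (lim_state G J) / 2 * ((?lt J rho + v * ?lx J rho) / r + (?lt J p11 + v * ?lx J p11) / p))" for J
    using pos R(1) unfolding lf_def by (simp add: field_simps)
  \<comment> \<open>The derivatives of \<open>\<rho>\<close> and \<open>p\<^sub>1\<^sub>1\<close> along the curve can be taken from the outer zone on both sides;
    the jump of \<open>p\<^sub>1\<^sub>2\<close> remains as their factor.\<close>
  have bal: "D u2 + \<sigma> / R * (D p12 - p12 (lim_state G K) / 2 * (D rho / r + D p11 / p)) =
      (?lt K' u2 + v * ?lx K' u2) + \<sigma> / R * ((?lt K' p12 + v * ?lx K' p12)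
      - p12 (lim_state G K') / 2 * (D rho / r + D p11 / p))"
  proof -
    have "D q = ?lt K q + v * ?lx K q" if "q \<in> components" for q
      unfolding D_def origin_lim_directional[OF that] ..
    then show ?thesis
      using f_same unfolding dir same[OF invariants(1) components_members(1), symmetric]
        same[OF invariants(2) components_members(4), symmetric] by simp
  qed

  have to_material: "?lt K' q + v * ?lx K' q = lim_material G K' q - \<sigma> * (p / R) * ?lx K' q"
    if "q \<in> components" for q
    unfolding lim_material_eq[OF that] common v by (simp add: algebra_simps)
  have u2': "?lt K' u2 + v * ?lx K' u2 = lim_material G K' u2
      + \<sigma> / R * (lim_material G K' p12 - 2 * p12 (lim_state G K') / (3 * p) * lim_material G K' p11)"
    unfolding to_material[OF components_members(3)] unfolding limit_space_derivatives common
    using pos R(1) by (simp add: field_simps)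
  \<comment> \<open>Here \<open>(v - u\<^sub>1) \<partial>\<^sub>x p\<^sub>1\<^sub>2\<close> turns into a second copy of \<open>D u\<^sub>2/Dt\<close>, as \<open>\<sigma>\<^sup>2 = 1\<close> and \<open>R\<^sup>2 = \<rho> p\<^sub>1\<^sub>1\<close>.\<close>
  have p12': "\<sigma> / R * (?lt K' p12 + v * ?lx K' p12) =
      \<sigma> / R * lim_material G K' p12 + lim_material G K' u2"
  proof -
    have "\<sigma> / R * (?lt K' p12 + v * ?lx K' p12) =
        \<sigma> / R * lim_material G K' p12 + (\<sigma> * \<sigma>) * (r * p) / (R * R) * lim_material G K' u2"
      unfolding to_material[OF components_members(5)]
      unfolding limit_space_derivatives rho' r_def[symmetric]
      by (simp add: algebra_simps)
    then show ?thesis using \<sigma> R pos by simp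
  qed
  have last: "2 * p12 (lim_state G K') * (v - u1 (lim_state G K)) / (3 * p\<^sup>2) * lim_material G K' p11 =
      - (\<sigma> / R * (2 * p12 (lim_state G K') / (3 * p) * lim_material G K' p11))"
    unfolding v using pos by (simp add: field_simps power2_eq_square)
  have "\<Delta> / (2 * r * R) * D rho + \<Delta> / (2 * p * R) * D p11 = \<sigma> / R * (p12 (lim_state G K') / 2 * (D rho / r + D p11 / p))
     - \<sigma> / R * (p12 (lim_state G K) / 2 * (D rho / r + D p11 / p))"
    unfolding \<Delta>_def using pos R(1) by (simp add: field_simps)
  then show ?thesis
    unfolding R_def[symmetric] last using bal unfolding u2' right_diff_distrib p12'
    by (simp add: right_diff_distrib)
qed

end

section \<open>Solving the two equations\<close>

lemma nonlinear_wave_edges_continuous: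
  assumes "nonlinear_wave G \<mu> a b"
  shows "continuous_on (time_dom G) a" and "continuous_on (time_dom G) b"
proof -
  have "continuous_on (time_dom G) a \<and> continuous_on (time_dom G) b"
    using assms unfolding nonlinear_wave_def
  proof
    assume "shock G \<mu> a b"
    then have "continuous_on (time_dom G) a" "\<And>t. t \<in> time_dom G \<Longrightarrow> a t = b t"
      using C1_differentiable_imp_continuous_on unfolding shock_def by blast+
    then show ?thesis using continuous_on_eq[of "time_dom G" a b] by blast
  next
    assume "rarefaction G \<mu> a b"
    then show ?thesis
      by (auto simp: rarefaction_def moves_with_def intro: C1_differentiable_imp_continuous_on)
  qed
  then show "continuous_on (time_dom G) a" and "continuous_on (time_dom G) b" by auto
qed

lemma shared_limits:
  assumes "grp_solution G"
  shows "u1 (lim_state G K) = u1 (lim_state G SL)"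
    and "p11 (lim_state G K) = p11 (lim_state G SL)"
    and "lim_material G K p11 = lim_material G SL p11"
    and "rho (lim_state G SSL) = rho (lim_state G SL)"
    and "rho (lim_state G SSR) = rho (lim_state G SR)"
    and "p12 (lim_state G SSR) = p12 (lim_state G SSL)"
    and "lim_material G SSR u2 = lim_material G SSL u2"
    and "lim_material G SSR p12 = lim_material G SSL p12"
  using assms unfolding grp_solution_def common_limits_def by metis+

lemma shear_relations:
  assumes "grp_solution G"
  shows "a5L G * Du2_ss G + b5L G * Dp12_ss G = d5L G"
    and "a5R G * Du2_ss G + b5R G * Dp12_ss G = d5R G"
proof -
  note wp = assms[unfolded grp_solution_def wave_pattern_def]
  have speeds: "moves_with G (shear2 G) (\<lambda>s. u1 s - 1 * (c_speed s / sqrt 3))"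
    "moves_with G (shear5 G) (\<lambda>s. u1 s - (- 1) * (c_speed s / sqrt 3))"
    using wp by simp_all
  with wp have cont: "continuous_on (time_dom G) (shear2 G)" "continuous_on (time_dom G) (contact G)"
    "continuous_on (time_dom G) (shear5 G)"
    by (auto simp: moves_with_def intro: C1_differentiable_imp_continuous_on)
  have contw: "continuous_on (time_dom G) (wave1_right G)" "continuous_on (time_dom G) (wave6_left G)"
    using wp nonlinear_wave_edges_continuous by blast+
  have b: "borders (horizon G) (shear2 G) (- 1) (zone G SL)" "borders (horizon G) (shear2 G) 1 (zone G SSL)"
    "borders (horizon G) (shear5 G) (- (- 1)) (zone G SR)" "borders (horizon G) (shear5 G) (- 1) (zone G SSR)"
    unfolding zone.simps minus_minus
    by (intro strip_borders_edges cont contw; use wp in blast)+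
  have \<xi>0: "(shear2 G \<longlongrightarrow> 0) (at_right 0)" "(shear5 G \<longlongrightarrow> 0) (at_right 0)"
    using wp by blast+
  have inv2: "continuous_across G rho (shear2 G)" "continuous_across G p11 (shear2 G)"
    "continuous_across G (\<lambda>s. u2 s + 1 * p12 s / sqrt (rho s * p11 s)) (shear2 G)"
    and inv5: "continuous_across G rho (shear5 G)" "continuous_across G p11 (shear5 G)"
    "continuous_across G (\<lambda>s. u2 s + (- 1) * p12 s / sqrt (rho s * p11 s)) (shear5 G)"
    using wp by simp_all
  note shared = shared_limits[OF assms]
  note defs = D2_sL_def D5_sR_def lambda2_def lambda5_def rho_sL_def rho_sR_def u1_s_def p11_s_def
    p12_sL_def p12_ss_def p12_sR_def Dp11_s_def Du2_ss_def Dp12_ss_def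
  show "a5L G * Du2_ss G + b5L G * Dp12_ss G = d5L G"
    using shear_relation[OF assms \<xi>0(1) b(1,2) speeds(1) inv2 shared(4)]
    unfolding a5L_def b5L_def d5L_def defs shared(1-3)[of SSL] by simp
  show "a5R G * Du2_ss G + b5R G * Dp12_ss G = d5R G"
    using shear_relation[OF assms \<xi>0(2) b(3,4) speeds(2) inv5 shared(5)]
    unfolding a5R_def b5R_def d5R_def defs shared(1-3)[of SSR] shared(1-3)[of SR] shared(6-8) by simp
qed

theorem theorem5p20:
  fixes G :: grp
  assumes "grp_solution G" and "nonsonic G"
    and "lambda2 G < 0" and "lambda5 G > 0"
  shows "Du2_ss G = (d5L G * b5R G - d5R G * b5L G) / (a5L G * b5R G - a5R G * b5L G)
    \<and> Dp12_ss G = (d5L G * a5R G - d5R G * a5L G) / (a5R G * b5L G - a5L G * b5R G)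
    \<and> (\<forall>(K, rho_sK) \<in> {(SSL, rho_sL G), (SSR, rho_sR G)}.
         origin_lim G K (dt (u2 \<circ> sol G)) =
           Du2_ss G + u1_s G / p11_s G * (Dp12_ss G - 2 * p12_ss G / (3 * p11_s G) * Dp11_s G)
       \<and> origin_lim G K (dt (p12 \<circ> sol G)) = Dp12_ss G + rho_sK * u1_s G * Du2_ss G)"
proof -
  note G = assms(1)
  note shared = shared_limits[OF G]
  have "0 < b5L G" "b5R G < 0"
    using lim_state_pos[OF G, of SL] lim_state_pos[OF G, of SR]
      shared(2)[of SR]
    by (simp_all add: b5L_def b5R_def rho_sL_def rho_sR_def p11_s_def)
  then have det: "a5L G * b5R G - a5R G * b5L G < 0"
    by (simp add: a5L_def a5R_def)
  note defs = rho_sL_def rho_sR_def u1_s_def p11_s_def p12_ss_def Dp11_s_def Du2_ss_def Dp12_ss_def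
  have times: "origin_lim G K (dt (u2 \<circ> sol G)) =
           Du2_ss G + u1_s G / p11_s G * (Dp12_ss G - 2 * p12_ss G / (3 * p11_s G) * Dp11_s G)
       \<and> origin_lim G K (dt (p12 \<circ> sol G)) = Dp12_ss G + rho (lim_state G K) * u1_s G * Du2_ss G"
    if "K = SSL \<or> K = SSR" for K
    using that limit_time_derivatives[OF G, of K]
    unfolding defs shared(1-3)[of K] by (auto simp: shared(6-8))
  have "Du2_ss G * (a5L G * b5R G - a5R G * b5L G) = d5L G * b5R G - d5R G * b5L G"
    "Dp12_ss G * (a5R G * b5L G - a5L G * b5R G) = d5L G * a5R G - d5R G * a5L G"
    unfolding shear_relations[OF G, symmetric] by (simp_all add: algebra_simps)
  then have "Du2_ss G = (d5L G * b5R G - d5R G * b5L G) / (a5L G * b5R G - a5R G * b5L G)"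
    "Dp12_ss G = (d5L G * a5R G - d5R G * a5L G) / (a5R G * b5L G - a5L G * b5R G)"
    using det by (simp_all add: eq_divide_eq)
  moreover have "rho_sL G = rho (lim_state G SSL)" "rho_sR G = rho (lim_state G SSR)"
    using shared(4,5) by (simp_all add: defs)
  ultimately show ?thesis using times[of SSL] times[of SSR] by simp
qed

end
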